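(* Let $k\ge2$ be an integer, $L>0$, let $\mathcal{D}$ be a good probability distribution on $[0,1]^{k-1}$, and let $1/k<r\le 1$. Consider the continuous fragmentation process with $k$ parts started from a single ($R=1$) living stick of length $L$, in which each newly created stick is alive with probability $r$ and dead with probability $1-r$, independently. Then with positive probability the process does not end in finitely many levels.
   Context: Good distributions: let $\mathcal{D}$ be a probability distribution on $\mathbb{R}^d$ supported on $[0,1]^d$. For $X\sim\mathcal{D}$ let $\mathrm{rk}_i(X)$ be its $i$-th smallest coordinate ($1\le i\le d$), $\mathrm{rk}_0(X)=0$, $\mathrm{rk}_{d+1}(X)=1$. $\mathcal{D}$ is good if for all $0\le i\le d$ the random variable $\mathrm{rk}_{i+1}(X)-\mathrm{rk}_i(X)$ has a Hölder continuous density (a density being a function on $[0,\infty)$). Process: the initial stick is alive. At each level every living stick, of length $\ell$ say, is broken into $k$ pieces of lengths $\ell(\mathrm{rk}_{i+1}(X)-\mathrm{rk}_i(X))$, $0\le i\le k-1$, where $X\sim\mathcal{D}$ is sampled independently for each living stick. Each new piece is then declared alive (it will be broken at the next level) or dead (it is never broken again). The process ends when there are no living sticks. *)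

theory Defs
  imports "HOL-Probability.Probability"
begin

(* rk i x for 0 <= i <= d + 1, where d = CARD('n): the order statistics of the coordinates of x,
   counted with multiplicity, extended by rk 0 x = 0 and rk (d + 1) x = 1. *)
definition rk :: "nat \<Rightarrow> real ^ 'n \<Rightarrow> real" where
  "rk i x = (0 # sorted_list_of_multiset (image_mset (($) x) (mset_set UNIV)) @ [1]) ! i"

definition holder_continuous_on :: "real set \<Rightarrow> (real \<Rightarrow> real) \<Rightarrow> bool" where
  "holder_continuous_on S f \<longleftrightarrow>
     (\<exists>C \<alpha>. 0 < \<alpha> \<and> \<alpha> \<le> 1 \<and> (\<forall>s\<in>S. \<forall>t\<in>S. \<bar>f s - f t\<bar> \<le> C * \<bar>s - t\<bar> powr \<alpha>))"

(* Hoelder continuity is required on [0, oo) only: extended by 0 to the negative reals,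
   the density may jump at 0. *)
definition good_distribution :: "(real ^ 'n) measure \<Rightarrow> bool" where
  "good_distribution D \<longleftrightarrow>
     prob_space D \<and> sets D = sets borel \<and> (AE x in D. \<forall>j. 0 \<le> x $ j \<and> x $ j \<le> 1) \<and>
     (\<forall>i \<le> CARD('n). \<exists>f. (\<forall>t\<ge>0. 0 \<le> f t) \<and> holder_continuous_on {0..} f \<and>
        distributed D lborel (\<lambda>x. rk (i + 1) x - rk i x) (\<lambda>t. ennreal (f t) * indicator {0..} t))"

(* Sticks are labelled by words over {0..<k}: the initial stick is [], and the pieces of the stick w
   are w @ [0], ..., w @ [k - 1]. For each word w, x w is the point at which the stick w is broken
   if it is alive, and a w says whether the stick w is declared alive when it is created.
   A living stick is recorded with its label, so that sticks of equal length stay distinct. *)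
fun living_sticks ::
  "nat \<Rightarrow> real \<Rightarrow> (nat list \<Rightarrow> real ^ 'n) \<Rightarrow> (nat list \<Rightarrow> bool) \<Rightarrow> nat \<Rightarrow> (nat list \<times> real) set" where
  "living_sticks k L x a 0 = {([], L)}"
| "living_sticks k L x a (Suc n) =
     {(w @ [i], l * (rk (i + 1) (x w) - rk i (x w))) | w l i.
        (w, l) \<in> living_sticks k L x a n \<and> i < k \<and> a (w @ [i])}"

definition process_ends ::
  "nat \<Rightarrow> real \<Rightarrow> (nat list \<Rightarrow> real ^ 'n) \<Rightarrow> (nat list \<Rightarrow> bool) \<Rightarrow> bool" where
  "process_ends k L x a \<longleftrightarrow> (\<exists>n. living_sticks k L x a n = {})"

(* The randomness of the process: all X w and A w are independent, X w has law D, and A w is true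
   with probability r. The mark A [] is unused, as the initial stick is always alive, and so is
   X w for every stick w that is dead or never created. *)
locale fragmentation_randomness = prob_space M
  for M :: "'a measure" +
  fixes k :: nat and r :: real and D :: "(real ^ 'n) measure"
    and X :: "nat list \<Rightarrow> 'a \<Rightarrow> real ^ 'n" and A :: "nat list \<Rightarrow> 'a \<Rightarrow> bool"
  assumes indep: "indep_vars (\<lambda>_. borel \<Otimes>\<^sub>M count_space UNIV) (\<lambda>w \<omega>. (X w \<omega>, A w \<omega>)) (lists {..<k})"
    and law: "\<And>w. w \<in> lists {..<k} \<Longrightarrow>
      distr M (borel \<Otimes>\<^sub>M count_space UNIV) (\<lambda>\<omega>. (X w \<omega>, A w \<omega>)) = D \<Otimes>\<^sub>M measure_pmf (bernoulli_pmf r)"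

end

theory Submission imports Defs begin

text \<open>
  A living stick is broken whatever its length is, so the marks alone decide whether the process ends:
  the labels of the living sticks form a Galton--Watson tree whose offspring law is binomial
  with parameters \<open>k\<close> and \<open>r\<close>. Its mean \<open>k * r\<close> exceeds 1, and the claim is that such a tree is infinite
  with positive probability.

  Let \<open>p n\<close> be the probability that a given stick has a lineage of length \<open>n\<close>, that is, it is marked
  alive and so are successive descendants of it for \<open>n\<close> further levels. The subtrees below the \<open>k\<close>
  pieces of a stick use disjoint sets of marks, so \<open>p 0 = r\<close> and \<open>p (n + 1) = F (p n)\<close> with
  \<open>F p = r * (1 - (1 - p) ^ k)\<close> (lemma \<open>prob_lineage_Suc\<close>). The function \<open>F\<close> is increasing on \<open>[0, 1]\<close>
  with \<open>F 0 = 0\<close> and slope \<open>r * k > 1\<close> at 0, so it maps some \<open>b > 0\<close> to at least \<open>b\<close>, and then no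
  \<open>p n\<close> falls below \<open>b\<close>. An explicit choice is \<open>b = r * c\<close> with \<open>c = 1 - 1 / (k * r)\<close> (lemmas
  \<open>offspring_bound\<close> and \<open>prob_lineage_ge\<close>). The events ``some stick is alive at level \<open>n\<close>'' decrease
  with \<open>n\<close> and all have probability at least \<open>b\<close>; so has their intersection.
\<close>

section \<open>The tree of living sticks\<close>

fun has_descendants :: "nat \<Rightarrow> (nat list \<Rightarrow> bool) \<Rightarrow> nat \<Rightarrow> nat list \<Rightarrow> bool" where
  "has_descendants k a 0 w \<longleftrightarrow> True"
| "has_descendants k a (Suc n) w \<longleftrightarrow> (\<exists>i<k. a (w @ [i]) \<and> has_descendants k a n (w @ [i]))"

lemma has_descendants_antimono: "has_descendants k a (Suc n) w \<Longrightarrow> has_descendants k a n w"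
proof (induction n arbitrary: w)
  case 0
  then show ?case by simp
next
  case (Suc n)
  from Suc.prems obtain i where i: "i < k" "a (w @ [i])" "has_descendants k a (Suc n) (w @ [i])"
    by (subst (asm) has_descendants.simps(2)) blast
  with Suc.IH[OF i(3)] show ?case by auto
qed

text \<open>
  The process grows words at their end while \<open>has_descendants\<close> looks ahead from a word. Trading levels
  one at a time between the two counts \<open>m\<close> and \<open>n\<close> reconciles them.
\<close>

lemma living_sticks_add_nonempty_iff:
  "living_sticks k L x a (m + n) \<noteq> {} \<longleftrightarrow>
     (\<exists>(w, l) \<in> living_sticks k L x a m. has_descendants k a n w)"
proof (induction n arbitrary: m)
  case 0
  then show ?case by auto
next
  case (Suc n)
  have "living_sticks k L x a (m + Suc n) \<noteq> {} \<longleftrightarrow>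
      (\<exists>(w, l) \<in> living_sticks k L x a (Suc m). has_descendants k a n w)"
    using Suc.IH[of "Suc m"] by simp
  also have "\<dots> \<longleftrightarrow> (\<exists>(w, l) \<in> living_sticks k L x a m. has_descendants k a (Suc n) w)"
    by fastforce
  finally show ?case .
qed

lemma not_process_ends_iff: "\<not> process_ends k L x a \<longleftrightarrow> (\<forall>n. has_descendants k a n [])"
  using living_sticks_add_nonempty_iff[of k L x a 0] by (simp add: process_ends_def)

text \<open>
  Having living descendants depends only on the marks of the words that extend \<open>w\<close>. For use with
  independence this is needed in two forms: the property is unchanged when the marks are restricted to
  a set \<open>K\<close> that contains all extensions of \<open>w\<close>, and it is measurable in the marks of these extensions.
\<close>

lemma has_descendants_restrict:
  assumes "\<And>u. u \<in> lists {..<k} \<Longrightarrow> w @ u \<in> K"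
  shows "has_descendants k (restrict a K) n w \<longleftrightarrow> has_descendants k a n w"
  using assms
proof (induction n arbitrary: w)
  case 0
  then show ?case by simp
next
  case (Suc n)
  have ext: "w @ i # u \<in> K" if "i < k" "u \<in> lists {..<k}" for i u
    using that by (intro Suc.prems) auto
  have "has_descendants k (restrict a K) n (w @ [i]) \<longleftrightarrow> has_descendants k a n (w @ [i])"
    if "i < k" for i
    using ext[OF that] by (intro Suc.IH) simp
  moreover have "restrict a K (w @ [i]) \<longleftrightarrow> a (w @ [i])" if "i < k" for i
    using ext[OF that, of "[]"] by simp
  ultimately show ?case by (simp cong: conj_cong del: restrict_apply)
qed

lemma measurable_has_descendants:
  assumes "\<And>u. u \<in> lists {..<k} \<Longrightarrow> (\<lambda>\<omega>. a \<omega> (w @ u)) \<in> measurable N (count_space UNIV)"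
  shows "(\<lambda>\<omega>. has_descendants k (a \<omega>) n w) \<in> measurable N (count_space UNIV)"
  using assms
proof (induction n arbitrary: w)
  case 0
  then show ?case by simp
next
  case (Suc n)
  have ext: "(\<lambda>\<omega>. a \<omega> (w @ i # u)) \<in> measurable N (count_space UNIV)"
    if "i \<in> {..<k}" "u \<in> lists {..<k}" for i u
    using that by (intro Suc.prems) auto
  have [measurable]: "(\<lambda>\<omega>. a \<omega> (w @ [i])) \<in> measurable N (count_space UNIV)" if "i \<in> {..<k}" for i
    using ext[OF that, of "[]"] by simp
  have [measurable]: "(\<lambda>\<omega>. has_descendants k (a \<omega>) n (w @ [i])) \<in> measurable N (count_space UNIV)"
    if "i \<in> {..<k}" for i
    using ext[OF that] by (intro Suc.IH) simp
  have "(\<lambda>\<omega>. \<exists>i\<in>{..<k}. a \<omega> (w @ [i]) \<and> has_descendants k (a \<omega>) n (w @ [i]))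
      \<in> measurable N (count_space UNIV)"
    by measurable
  then show ?case by (simp add: Bex_def)
qed

section \<open>The extinction recursion\<close>

text \<open>
  From \<open>(1 - y) ^ k \<le> 1 / (1 + y) ^ k \<le> 1 / (1 + k * y)\<close> with \<open>y = r * c\<close>, the claim reduces to
  \<open>1 \<le> (1 - c) * (1 + k * r * c)\<close>, in which the given \<open>c > 0\<close> attains equality.
\<close>

lemma offspring_bound:
  fixes r c :: real
  assumes "1 < real k * r" "0 \<le> r" "r \<le> 1" and c: "c = 1 - 1 / (real k * r)"
  shows "(1 - r * c) ^ k \<le> 1 - c"
proof -
  have "k \<noteq> 0" "r \<noteq> 0"
    using assms(1) by (metis mult_zero_left mult_zero_right not_one_less_zero of_nat_0)+
  then have kr: "0 < k" "0 < r" "1 < real k * r"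
    using assms(1,2) by simp_all
  then have c01: "0 < c" "c < 1" using assms(1) by (auto simp: c)
  have y: "0 \<le> r * c" "r * c \<le> 1"
    using c01 assms by (auto intro: mult_le_one)
  have eq: "(1 - c) * (1 + real k * (r * c)) = 1"
    using kr by (auto simp: c field_simps)
  have "1 + real k * (r * c) \<le> (1 + r * c) ^ k"
    using Bernoulli_inequality[of "r * c" k] y by simp
  then have "(1 - r * c) ^ k * (1 + real k * (r * c)) \<le> (1 - r * c) ^ k * (1 + r * c) ^ k"
    using y by (intro mult_left_mono) auto
  also have "\<dots> = (1 - (r * c)\<^sup>2) ^ k"
    unfolding power_mult_distrib[symmetric]
    by (rule arg_cong[where f = "\<lambda>z. z ^ k"]) (simp add: power2_eq_square algebra_simps)
  also have "\<dots> \<le> 1"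
    using y by (intro power_le_one) (auto simp: power_le_one)
  finally have "(1 - r * c) ^ k * (1 + real k * (r * c)) \<le> (1 - c) * (1 + real k * (r * c))"
    using eq by simp
  moreover have "0 < 1 + real k * (r * c)" using y by (simp add: add_pos_nonneg)
  ultimately show ?thesis by (simp only: mult_le_cancel_right_pos)
qed

section \<open>Survival with independent marks\<close>

locale independent_marks = prob_space M
  for M :: "'a measure" +
  fixes k :: nat and r :: real and A :: "nat list \<Rightarrow> 'a \<Rightarrow> bool"
  assumes indep_marks: "indep_vars (\<lambda>_. count_space UNIV) A (lists {..<k})"
    and prob_mark: "w \<in> lists {..<k} \<Longrightarrow> prob {\<omega> \<in> space M. A w \<omega>} = r"
begin

lemma measurable_mark: "w \<in> lists {..<k} \<Longrightarrow> A w \<in> measurable M (count_space UNIV)"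
  using indep_marks by (auto simp: indep_vars_def)

lemma measurable_descendants:
  "w \<in> lists {..<k} \<Longrightarrow> (\<lambda>\<omega>. has_descendants k (\<lambda>v. A v \<omega>) n w) \<in> measurable M (count_space UNIV)"
  by (intro measurable_has_descendants measurable_mark) auto

definition lineage :: "nat \<Rightarrow> nat list \<Rightarrow> 'a set" where
  "lineage n w = {\<omega> \<in> space M. A w \<omega> \<and> has_descendants k (\<lambda>v. A v \<omega>) n w}"

lemma lineage_in_events: "w \<in> lists {..<k} \<Longrightarrow> lineage n w \<in> events"
  unfolding lineage_def
  using measurable_mark[of w] measurable_descendants[of w n] by measurable

text \<open>
  A living stick has no lineage of length \<open>n + 1\<close> exactly if none of its pieces has a lineage of
  length \<open>n\<close>. The corresponding \<open>k\<close> events and the mark of \<open>w\<close> are determined by disjoint blocks of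
  marks, so their probabilities multiply. Below, the blocks \<open>K v\<close> are indexed by the words \<open>w\<close> and
  \<open>w @ [i]\<close> that they start from, and \<open>g v\<close> is the event in the block of \<open>v\<close>.
\<close>

lemma prob_alive_without_lineage:
  assumes w: "w \<in> lists {..<k}"
  shows "prob {\<omega> \<in> space M. A w \<omega> \<and> \<not> has_descendants k (\<lambda>v. A v \<omega>) (Suc n) w} =
    r * (\<Prod>i<k. 1 - prob (lineage n (w @ [i])))"
proof -
  define J where "J = insert w ((\<lambda>i. w @ [i]) ` {..<k})"
  define K where "K v = (if v = w then {w} else (\<lambda>u. v @ u) ` lists {..<k})" for v
  define g where "g v a \<longleftrightarrow> (if v = w then a w else \<not> (a v \<and> has_descendants k a n v))"
    for v and a :: "nat list \<Rightarrow> bool"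
  define Z where "Z v \<omega> = g v (\<lambda>u. A u \<omega>)" for v \<omega>
  have indep_blocks: "indep_vars (\<lambda>v. PiM (K v) (\<lambda>_. count_space UNIV))
      (\<lambda>v \<omega>. restrict (\<lambda>u. A u \<omega>) (K v)) J"
  proof (rule indep_vars_restrict[OF indep_marks])
    show "K v \<subseteq> lists {..<k}" if "v \<in> J" for v
      using that w by (auto simp: K_def J_def)
    show "disjoint_family_on K J"
      by (auto simp: disjoint_family_on_def K_def J_def)
  qed
  have "indep_vars (\<lambda>_. count_space UNIV) (\<lambda>v \<omega>. g v (restrict (\<lambda>u. A u \<omega>) (K v))) J"
  proof (rule indep_vars_compose2[OF indep_blocks])
    fix v assume "v \<in> J"
    show "g v \<in> measurable (PiM (K v) (\<lambda>_. count_space UNIV)) (count_space UNIV)"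
    proof (cases "v = w")
      case True
      have "(\<lambda>a. a w) \<in> measurable (PiM (K v) (\<lambda>_. count_space UNIV)) (count_space (UNIV :: bool set))"
        using True by (intro measurable_component_singleton) (simp add: K_def)
      with True show ?thesis by (simp add: g_def[abs_def])
    next
      case False
      have mark: "(\<lambda>a. a (v @ u)) \<in> measurable (PiM (K v) (\<lambda>_. count_space UNIV))
          (count_space (UNIV :: bool set))" if "u \<in> lists {..<k}" for u
        using that False by (intro measurable_component_singleton) (simp add: K_def)
      have "(\<lambda>a. has_descendants k a n v)
          \<in> measurable (PiM (K v) (\<lambda>_. count_space UNIV)) (count_space UNIV)"
        by (rule measurable_has_descendants) (rule mark)
      then have "(\<lambda>a. \<not> (a v \<and> has_descendants k a n v))
          \<in> measurable (PiM (K v) (\<lambda>_. count_space UNIV)) (count_space UNIV)"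
        using mark[of "[]"]
        by (intro pred_intros_logic) simp_all
      with False show ?thesis by (simp add: g_def[abs_def])
    qed
  qed
  also have "?this \<longleftrightarrow> indep_vars (\<lambda>_. count_space UNIV) Z J"
  proof (intro indep_vars_cong refl ext)
    fix v \<omega> assume "v \<in> J"
    show "g v (restrict (\<lambda>u. A u \<omega>) (K v)) = Z v \<omega>"
    proof (cases "v = w")
      case True
      then show ?thesis by (simp add: g_def Z_def K_def)
    next
      case False
      then have ext: "v @ u \<in> K v" if "u \<in> lists {..<k}" for u
        using that by (simp add: K_def)
      have "v \<in> K v" using ext[of "[]"] by simp
      then show ?thesis
        using False has_descendants_restrict[OF ext, where a = "\<lambda>u. A u \<omega>" and n = n]
        by (simp add: g_def Z_def)
    qed
  qed
  finally have indep_Z: "indep_vars (\<lambda>_. count_space UNIV) Z J" .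
  have Z_piece_iff: "Z (w @ [i]) \<omega> \<longleftrightarrow>
      \<not> (A (w @ [i]) \<omega> \<and> has_descendants k (\<lambda>u. A u \<omega>) n (w @ [i]))"
    for i \<omega>
    by (simp add: Z_def g_def)
  have Z_root_iff: "Z w \<omega> \<longleftrightarrow> A w \<omega>" for \<omega>
    by (simp add: Z_def g_def)
  have Z_piece: "Z (w @ [i]) -` {True} \<inter> space M = space M - lineage n (w @ [i])" for i
    unfolding lineage_def vimage_def Z_piece_iff by blast
  have Z_root: "Z w -` {True} \<inter> space M = {\<omega> \<in> space M. A w \<omega>}"
    unfolding vimage_def Z_root_iff by blast
  have "{\<omega> \<in> space M. A w \<omega> \<and> \<not> has_descendants k (\<lambda>v. A v \<omega>) (Suc n) w} =
      (\<Inter>v\<in>J. Z v -` {True} \<inter> space M)"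
    unfolding J_def vimage_def by (auto simp: Z_piece_iff Z_root_iff)
  also have "prob \<dots> = (\<Prod>v\<in>J. prob (Z v -` {True} \<inter> space M))"
    by (rule indep_varsD[OF indep_Z]) (auto simp: J_def)
  also have "\<dots> = prob (Z w -` {True} \<inter> space M) *
      (\<Prod>i<k. prob (Z (w @ [i]) -` {True} \<inter> space M))"
    unfolding J_def by (subst prod.insert) (auto simp: prod.reindex inj_on_def)
  also have "\<dots> = r * (\<Prod>i<k. 1 - prob (lineage n (w @ [i])))"
    unfolding Z_piece Z_root prob_mark[OF w]
    using w by (auto intro!: prod.cong prob_compl lineage_in_events)
  finally show ?thesis .
qed

lemma prob_lineage_Suc:
  assumes w: "w \<in> lists {..<k}"
  shows "prob (lineage (Suc n) w) = r * (1 - (\<Prod>i<k. 1 - prob (lineage n (w @ [i]))))"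
proof -
  let ?B = "{\<omega> \<in> space M. A w \<omega> \<and> \<not> has_descendants k (\<lambda>v. A v \<omega>) (Suc n) w}"
  have [measurable]: "A w \<in> measurable M (count_space UNIV)"
    "(\<lambda>\<omega>. has_descendants k (\<lambda>v. A v \<omega>) (Suc n) w) \<in> measurable M (count_space UNIV)"
    by (rule measurable_mark[OF w] measurable_descendants[OF w])+
  have B: "?B \<in> events" by measurable
  have alive: "{\<omega> \<in> space M. A w \<omega>} = lineage (Suc n) w \<union> ?B"
    and disjoint: "lineage (Suc n) w \<inter> ?B = {}"
    unfolding lineage_def by blast+
  have "prob {\<omega> \<in> space M. A w \<omega>} = prob (lineage (Suc n) w) + prob ?B"
    unfolding alive by (rule finite_measure_Union[OF lineage_in_events[OF w] B disjoint])
  then show ?thesis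
    unfolding prob_mark[OF w] prob_alive_without_lineage[OF w] by (simp add: algebra_simps)
qed

lemma prob_lineage_ge:
  assumes r: "1 < real k * r" "0 \<le> r" "r \<le> 1" and c: "c = 1 - 1 / (real k * r)"
  assumes w: "w \<in> lists {..<k}"
  shows "r * c \<le> prob (lineage n w)"
  using w
proof (induction n arbitrary: w)
  case 0
  have "r * c \<le> r * 1" using r by (intro mult_left_mono) (auto simp: c)
  with 0 show ?case by (simp add: lineage_def prob_mark)
next
  case (Suc n)
  have "(\<Prod>i<k. 1 - prob (lineage n (w @ [i]))) \<le> (\<Prod>i<k. 1 - r * c)"
    using Suc.prems by (intro prod_mono) (auto intro!: Suc.IH)
  also have "\<dots> \<le> 1 - c" using offspring_bound[OF r c] by simp
  finally have "c \<le> 1 - (\<Prod>i<k. 1 - prob (lineage n (w @ [i])))" by simp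
  with r(2) show ?case
    unfolding prob_lineage_Suc[OF Suc.prems] by (intro mult_left_mono)
qed

lemma prob_survival_pos:
  assumes r: "1 < real k * r" "r \<le> 1"
  shows "0 < prob {\<omega> \<in> space M. \<forall>n. has_descendants k (\<lambda>v. A v \<omega>) n []}"
proof -
  define c where "c = 1 - 1 / (real k * r)"
  have r0: "0 < r" using r(1)
    by (smt (verit) mult_nonneg_nonpos of_nat_0_le_iff)
  have "0 < c" using r by (simp add: c_def)
  define E where "E n = {\<omega> \<in> space M. has_descendants k (\<lambda>v. A v \<omega>) n []}" for n
  have E_events: "range E \<subseteq> events"
    using measurable_descendants[of "[]"] unfolding E_def by auto
  have "decseq E"
    by (rule decseq_SucI) (auto simp: E_def simp del: has_descendants.simps dest: has_descendants_antimono)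
  have "r * c \<le> prob (E n)" for n
  proof -
    \<comment> \<open>The initial stick lives whatever its mark is, so requiring this mark only shrinks the event.\<close>
    have "r * c \<le> prob (lineage n [])"
      using prob_lineage_ge[OF r(1) _ r(2) c_def, of "[]" n] r0 by simp
    also have "\<dots> \<le> prob (E n)"
      using E_events by (intro finite_measure_mono) (auto simp: lineage_def E_def)
    finally show ?thesis .
  qed
  then have "r * c \<le> prob (\<Inter>n. E n)"
    using finite_Lim_measure_decseq[OF E_events \<open>decseq E\<close>] by (intro LIMSEQ_le_const) auto
  also have "(\<Inter>n. E n) = {\<omega> \<in> space M. \<forall>n. has_descendants k (\<lambda>v. A v \<omega>) n []}"
    by (auto simp: E_def)
  finally show ?thesis using r0 \<open>0 < c\<close> by (meson less_le_trans mult_pos_pos)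
qed

end

section \<open>The fragmentation process\<close>

text \<open>
  Dropping the break points leaves independent Bernoulli marks. The second marginal of the product law
  is the Bernoulli law because \<open>D\<close> has total mass 1.
\<close>

lemma (in fragmentation_randomness) independent_marks_A:
  assumes D: "prob_space D" and sets_D: "sets D = sets borel" and r: "0 \<le> r" "r \<le> 1"
  shows "independent_marks M k r A"
proof
  show "indep_vars (\<lambda>_. count_space UNIV) A (lists {..<k})"
    using indep_vars_compose2[OF indep, of "\<lambda>_. snd" "\<lambda>_. count_space UNIV"] by simp
next
  fix w assume w: "w \<in> lists {..<k}"
  let ?B = "measure_pmf (bernoulli_pmf r)"
  interpret D: prob_space D by (rule D)
  have XA: "(\<lambda>\<omega>. (X w \<omega>, A w \<omega>)) \<in> measurable M (borel \<Otimes>\<^sub>M count_space UNIV)"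
    using indep w by (auto simp: indep_vars_def)
  have space_D: "space D = UNIV" using sets_eq_imp_space_eq[OF sets_D] by simp
  have sets: "UNIV \<times> {True} \<in> sets (borel \<Otimes>\<^sub>M count_space UNIV :: ((real ^ 'n) \<times> bool) measure)"
    by (intro pair_measureI) auto
  have "prob {\<omega> \<in> space M. A w \<omega>} =
      measure (distr M (borel \<Otimes>\<^sub>M count_space UNIV) (\<lambda>\<omega>. (X w \<omega>, A w \<omega>))) (UNIV \<times> {True})"
    by (subst measure_distr[OF XA sets]) (auto intro!: arg_cong[where f = prob])
  also have "\<dots> = measure (D \<Otimes>\<^sub>M ?B) (space D \<times> {True})"
    unfolding law[OF w] space_D ..
  also have "\<dots> = measure D (space D) * measure ?B {True}"
    using sets_D by (simp add: measure_def measure_pmf.emeasure_pair_measure_Times enn2real_mult space_D sets_eq_imp_space_eq)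
  also have "\<dots> = r"
    using r by (simp add: D.prob_space measure_pmf_single)
  finally show "prob {\<omega> \<in> space M. A w \<omega>} = r" .
qed

theorem theorem1p8:
  fixes k :: nat and L r :: real and D :: "(real ^ 'n) measure"
    and M :: "'a measure"
    and X :: "nat list \<Rightarrow> 'a \<Rightarrow> real ^ 'n" and A :: "nat list \<Rightarrow> 'a \<Rightarrow> bool"
  assumes "k \<ge> 2" and "CARD('n) = k - 1"
    and "L > 0"
    and "good_distribution D"
    and "1 / real k < r" and "r \<le> 1"
    and "fragmentation_randomness M k r D X A"
  shows "measure M {\<omega> \<in> space M. \<not> process_ends k L (\<lambda>w. X w \<omega>) (\<lambda>w. A w \<omega>)} > 0"
proof -
  have kr: "1 < real k * r" and r0: "0 \<le> r"
    using assms(1,5) by (auto simp: field_simps intro: order_trans[of 0 "1 / real k"])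
  interpret fragmentation_randomness M k r D X A by fact
  interpret independent_marks M k r A
    using independent_marks_A assms(4,6) r0 by (simp add: good_distribution_def)
  show ?thesis
    unfolding not_process_ends_iff by (rule prob_survival_pos[OF kr assms(6)])
qed

end
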